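(* Let $\omega$ be a nonempty factor of the period-doubling sequence $\mathbb{D}$. (1) If $Env(\omega)=E_{1,m}$ for some $m\ge 1$, then the return word sequence $\{r_p(\omega)\}_{p\ge1}$ in $\mathbb{D}$ is $\Theta_1$ over the alphabet $\{r_1(\omega),r_2(\omega)\}$; that is, for every $p\ge 1$, $r_p(\omega)=r_1(\omega)$ if $\Theta_1[p]=a$ and $r_p(\omega)=r_2(\omega)$ if $\Theta_1[p]=b$. (2) If $Env(\omega)=E_{2,m}$ for some $m\ge 1$, then the return word sequence $\{r_p(\omega)\}_{p\ge1}$ in $\mathbb{D}$ is $\Theta_2$ over the alphabet $\{r_1(\omega),r_2(\omega),r_4(\omega)\}$; that is, for every $p\ge1$, $r_p(\omega)=r_1(\omega)$ if $\Theta_2[p]=a$, $r_p(\omega)=r_2(\omega)$ if $\Theta_2[p]=b$, and $r_p(\omega)=r_4(\omega)$ if $\Theta_2[p]=c$.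
   Context: Let $\sigma$ be the substitution on $\{a,b\}$ with $\sigma(a)=ab$, $\sigma(b)=aa$, and let $\mathbb{D}=x_1x_2x_3\cdots=abaaabab\cdots$ be its infinite fixed point beginning with $a$ (the period-doubling sequence). Put $A_m=\sigma^m(a)$, $B_m=\sigma^m(b)$ for $m\ge0$, and let $\delta_m$ be the last letter of $A_m$ ($\delta_m=a$ if $m$ is even, $\delta_m=b$ if $m$ is odd). For a word $u$ with suffix $\nu$, $u\nu^{-1}$ denotes $u$ with this suffix removed. Envelope words: for $m\ge1$, $E_{1,m}=A_m\delta_m^{-1}$ and $E_{2,m}=B_mB_{m-1}\delta_m^{-1}$. They are totally ordered by $E_{1,1}\sqsubset E_{2,1}\sqsubset E_{1,2}\sqsubset E_{2,2}\sqsubset E_{1,3}\sqsubset\cdots$. For a factor (finite contiguous subword) $\omega$ of $\mathbb{D}$, $Env(\omega)$ is the $\sqsubset$-minimal envelope word that has $\omega$ as a factor. Return words: each nonempty factor $\omega$ occurs infinitely often in $\mathbb{D}$; let $\omega_p$ ($p\ge1$) be its $p$-th occurrence, ordered by starting position (occurrences may overlap). If $\omega_p$ starts at position $s$ and $\omega_{p+1}$ starts at position $t$, then the $p$-th return word is $r_p(\omega)=x_s x_{s+1}\cdots x_{t-1}$. $\Theta_1=\tau_1(\mathbb{D})$ and $\Theta_2=\tau_2(\mathbb{D})$, where $\tau_1,\tau_2$ are the morphisms $\tau_1(a)=a$, $\tau_1(b)=bb$; $\tau_2(a)=ab$, $\tau_2(b)=acac$. $\Theta_i[p]$ denotes the $p$-th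 letter of $\Theta_i$. *)

theory Defs
  imports "HOL-Library.Stream" "HOL-Library.Sublist" "HOL-Library.Infinite_Set"
begin

text \<open>
  Finite words are lists and infinite words are streams. Streams are indexed from 0,
  whereas letters, occurrences and return words are numbered from 1 in the mathematics.
\<close>

datatype letter = La | Lb

datatype letter3 = Ta | Tb | Tc

definition morph :: "('a \<Rightarrow> 'b list) \<Rightarrow> 'a list \<Rightarrow> 'b list" where
  "morph f w = concat (map f w)"

text \<open>Only used for non-erasing morphisms: \<^const>\<open>flat\<close> is unspecified on empty blocks.\<close>

definition morph_inf :: "('a \<Rightarrow> 'b list) \<Rightarrow> 'a stream \<Rightarrow> 'b stream" where
  "morph_inf f s = flat (smap f s)"

definition letter_at :: "'a stream \<Rightarrow> nat \<Rightarrow> 'a" where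
  "letter_at s p = s !! (p - 1)"

fun sigma :: "letter \<Rightarrow> letter list" where
  "sigma La = [La, Lb]"
| "sigma Lb = [La, La]"

definition period_doubling :: "letter stream" where
  "period_doubling = (THE s. shd s = La \<and> morph_inf sigma s = s)"

lemma stream_eqI: "(\<And>n. s !! n = t !! n) \<Longrightarrow> s = t"
  using smap_alt[of id s t] by (simp add: stream.map_id)

lemma morph_inf_sigma_snth:
  "morph_inf sigma s !! (2 * n) = La"
  "morph_inf sigma s !! Suc (2 * n) = (if s !! n = La then Lb else La)"
proof (induction n arbitrary: s)
  case 0
  {
    case 1
    show ?case by (cases s; cases "shd s") (auto simp: morph_inf_def)
  next
    case 2
    show ?case by (cases s; cases "shd s") (auto simp: morph_inf_def)
  }
next
  case (Suc n)
  have *: "stl (stl (morph_inf sigma s)) = morph_inf sigma (stl s)" for s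
    by (cases s; cases "shd s") (auto simp: morph_inf_def)
  {
    case 1
    show ?case using Suc(1)[of "stl s"] by (simp add: *)
  next
    case 2
    show ?case using Suc(2)[of "stl s"] by (simp add: *)
  }
qed

text \<open>The description in \<^const>\<open>period_doubling\<close> denotes.\<close>

lemma period_doubling_ex1: "\<exists>!s. shd s = La \<and> morph_inf sigma s = s"
proof -
  have key: "(shd s = La \<and> morph_inf sigma s = s) \<longleftrightarrow>
      (\<forall>n. s !! (2 * n) = La \<and> s !! Suc (2 * n) = (if s !! n = La then Lb else La))"
    (is "?L s \<longleftrightarrow> ?R s") for s
  proof
    assume "?L s"
    then show "?R s" using morph_inf_sigma_snth[of s] by metis
  next
    assume R: "?R s"
    have "morph_inf sigma s !! n = s !! n" for n
    proof (cases "even n")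
      case True
      then obtain k where "n = 2 * k" by blast
      then show ?thesis using R by (simp add: morph_inf_sigma_snth)
    next
      case False
      then obtain k where "n = Suc (2 * k)" by (auto elim: oddE)
      then show ?thesis using R morph_inf_sigma_snth(2)[of s k] by metis
    qed
    then have "morph_inf sigma s = s"
      by (rule stream_eqI)
    moreover have "shd s = La" using R by (metis mult_0_right snth.simps(1))
    ultimately show "?L s" by simp
  qed
  define f :: "nat \<Rightarrow> letter" where
    "f = wfrec less_than (\<lambda>g n. if even n then La else if g (n div 2) = La then Lb else La)"
  have f: "f n = (if even n then La else if f (n div 2) = La then Lb else La)" for n
    unfolding f_def
    by (subst wfrec[OF wf_less_than]) (use odd_pos[of n] in \<open>auto simp: cut_def\<close>)
  define d where "d = smap f (fromN 0)"
  have d: "d !! n = f n" for n by (simp add: d_def)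
  have ex: "?R d"
  proof
    fix n
    show "d !! (2 * n) = La \<and> d !! Suc (2 * n) = (if d !! n = La then Lb else La)"
      unfolding d using f[of "2 * n"] f[of "Suc (2 * n)"] by simp
  qed
  have uniq: "s = d" if s: "?R s" for s
  proof -
    have "s !! n = d !! n" for n
    proof (induction n rule: less_induct)
      case (less n)
      show ?case
      proof (cases "even n")
        case True
        then obtain k where "n = 2 * k" by blast
        then show ?thesis using s ex by simp
      next
        case False
        then obtain k where k: "n = Suc (2 * k)" by (auto elim: oddE)
        then have "s !! k = d !! k" using less.IH[of k] by simp
        then show ?thesis using s ex k by simp
      qed
    qed
    then show ?thesis by (metis stream_eqI)
  qed
  show ?thesis unfolding key using ex uniq by blast
qed

definition A_word :: "nat \<Rightarrow> letter list" where
  "A_word m = (morph sigma ^^ m) [La]"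

definition B_word :: "nat \<Rightarrow> letter list" where
  "B_word m = (morph sigma ^^ m) [Lb]"

definition delta :: "nat \<Rightarrow> letter" where
  "delta m = last (A_word m)"

text \<open>The word \<open>u\<close> with its suffix \<open>v\<close> removed; only meaningful if \<open>v\<close> is a suffix of \<open>u\<close>.\<close>

definition remove_suffix :: "'a list \<Rightarrow> 'a list \<Rightarrow> 'a list" where
  "remove_suffix u v = take (length u - length v) u"

text \<open>Both families are only meant for \<open>m \<ge> 1\<close>.\<close>

definition E1 :: "nat \<Rightarrow> letter list" where
  "E1 m = remove_suffix (A_word m) [delta m]"

definition E2 :: "nat \<Rightarrow> letter list" where
  "E2 m = remove_suffix (B_word m @ B_word (m - 1)) [delta m]"

text \<open>
  The envelope words in increasing order: positions 0, 1, 2, 3, \<open>\<dots>\<close> hold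
  \<open>E1 1\<close>, \<open>E2 1\<close>, \<open>E1 2\<close>, \<open>E2 2\<close>, \<open>\<dots>\<close>. Their lengths are strictly increasing, so comparing
  words is the same as comparing positions.
\<close>

definition envelope :: "nat \<Rightarrow> letter list" where
  "envelope k = (if even k then E1 (k div 2 + 1) else E2 (k div 2 + 1))"

definition Env :: "letter list \<Rightarrow> letter list" where
  "Env w = envelope (LEAST k. sublist w (envelope k))"

definition occurrences :: "'a list \<Rightarrow> 'a stream \<Rightarrow> nat set" where
  "occurrences w s = {i. stake (length w) (sdrop i s) = w}"

definition is_factor :: "'a list \<Rightarrow> 'a stream \<Rightarrow> bool" where
  "is_factor w s \<longleftrightarrow> occurrences w s \<noteq> {}"

text \<open>
  0-based starting position of the \<open>p\<close>-th occurrence, \<open>p \<ge> 1\<close>; \<^const>\<open>enumerate\<close> lists an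
  infinite set of naturals increasingly, starting with index 0.
\<close>

definition occ_pos :: "letter list \<Rightarrow> nat \<Rightarrow> nat" where
  "occ_pos w p = enumerate (occurrences w period_doubling) (p - 1)"

definition return_word :: "letter list \<Rightarrow> nat \<Rightarrow> letter list" where
  "return_word w p =
     stake (occ_pos w (p + 1) - occ_pos w p) (sdrop (occ_pos w p) period_doubling)"

fun tau1 :: "letter \<Rightarrow> letter list" where
  "tau1 La = [La]"
| "tau1 Lb = [Lb, Lb]"

fun tau2 :: "letter \<Rightarrow> letter3 list" where
  "tau2 La = [Ta, Tb]"
| "tau2 Lb = [Ta, Tc, Ta, Tc]"

definition Theta1 :: "letter stream" where
  "Theta1 = morph_inf tau1 period_doubling"

definition Theta2 :: "letter3 stream" where
  "Theta2 = morph_inf tau2 period_doubling"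

end

theory Submission
  imports Defs
begin

text \<open>
  A factor other than \<open>a\<close> and \<open>aa\<close> determines the parity of its occurrences, so it can be
  desubstituted: its occurrences are \<open>2 j + e\<close>, where \<open>j\<close> runs through the occurrences of a shorter
  window and \<open>e < 2\<close> is fixed, and its envelope moves down by two places. Iterating this, the
  occurrences of \<open>w\<close> are \<open>c + 2 ^ m * j\<close>, where \<open>j\<close> runs through the occurrences of \<open>a\<close> (if the
  envelope is \<open>E1 (m + 1)\<close>) or of \<open>aa\<close> (if it is \<open>E2 (m + 1)\<close>). The gaps between the occurrences
  of \<open>a\<close> spell \<open>Theta1\<close>; the occurrences of \<open>aa\<close> are \<open>4 q + 2\<close> and \<open>4 q + 3\<close> for the occurrences \<open>q\<close>
  of \<open>a\<close>, so their gaps spell \<open>Theta2\<close>. Equal letters give equal contents of the return words because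
  equal windows of length \<open>l\<close> at \<open>i\<close> and \<open>j\<close> force equal windows of length \<open>2 ^ m * (l + 1) - 1\<close> at
  \<open>2 ^ m * i\<close> and \<open>2 ^ m * j\<close>, which leaves room for the offset \<open>c\<close>.
\<close>

section \<open>Letters of the period-doubling sequence\<close>

declare snth.simps [simp del]

abbreviation pd :: "nat \<Rightarrow> letter" where
  "pd n \<equiv> period_doubling !! n"

lemma letter_neq_iff [simp]: "x \<noteq> La \<longleftrightarrow> x = Lb" "x \<noteq> Lb \<longleftrightarrow> x = La"
  by (cases x; simp)+

lemma morph_inf_period_doubling: "morph_inf sigma period_doubling = period_doubling"
  using theI'[OF period_doubling_ex1] unfolding period_doubling_def by blast

lemma pd_even [simp]: "pd (2 * n) = La"
  using morph_inf_sigma_snth(1)[of period_doubling n] morph_inf_period_doubling by simp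

lemma pd_odd [simp]: "pd (Suc (2 * n)) = (if pd n = La then Lb else La)"
  using morph_inf_sigma_snth(2)[of period_doubling n] morph_inf_period_doubling by simp

lemma pd_even': "even n \<Longrightarrow> pd n = La"
  by (metis dvdE pd_even)

lemma pd_odd': "odd n \<Longrightarrow> pd n = La \<longleftrightarrow> pd (n div 2) = Lb"
  by (auto elim!: oddE split: if_splits)

lemma pd_small: "pd 0 = La" "pd 1 = Lb" "pd 2 = La" "pd 3 = La" "pd 4 = La" "pd 5 = Lb"
  using pd_even[of 0] pd_odd[of 0] pd_even[of 1] pd_odd[of 1] pd_even[of 2] pd_odd[of 2]
  by (simp_all add: numeral_eq_Suc)

section \<open>Equal windows and how they grow under \<open>sigma\<close>\<close>

definition agree :: "nat \<Rightarrow> nat \<Rightarrow> nat \<Rightarrow> bool" where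
  "agree i j l \<longleftrightarrow> (\<forall>t<l. pd (i + t) = pd (j + t))"

lemma stake_sdrop_eq_iff_agree:
  "stake l (sdrop i period_doubling) = stake l (sdrop j period_doubling) \<longleftrightarrow> agree i j l"
  unfolding agree_def by (auto simp: list_eq_iff_nth_eq sdrop_snth)

lemma agree_shift:
  assumes "agree i j l" "c + n \<le> l"
  shows "agree (i + c) (j + c) n"
  using assms unfolding agree_def by (auto simp: add.assoc)

text \<open>Even positions always carry \<open>a\<close> and the letter at \<open>2 * n + 1\<close>
  depends only on the letter at \<open>n\<close>. The extra 1 in the length is the even position
  just after the doubled window.\<close>

lemma agree_double:
  assumes "agree i j l"
  shows "agree (2 * i) (2 * j) (2 * l + 1)"
  unfolding agree_def
proof (intro allI impI)
  fix t assume t: "t < 2 * l + 1"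
  show "pd (2 * i + t) = pd (2 * j + t)"
  proof (cases "even t")
    case True
    then show ?thesis by (simp add: pd_even')
  next
    case False
    then obtain s where s: "t = Suc (2 * s)" by (auto elim: oddE)
    then have "pd (i + s) = pd (j + s)" using assms t unfolding agree_def by simp
    then show ?thesis
      using pd_odd[of "i + s"] pd_odd[of "j + s"] by (simp add: s algebra_simps)
  qed
qed

text \<open>Iterating \<open>l\<close> to \<open>2 * l + 1\<close> doubles \<open>l + 1\<close> each
  time.\<close>

lemma agree_power:
  assumes "agree i j l"
  shows "agree (2 ^ m * i) (2 ^ m * j) (2 ^ m * (l + 1) - 1)"
proof (induction m)
  case (Suc m)
  have "(1 :: nat) \<le> 2 ^ m * (l + 1)" by (simp add: Suc_le_eq)
  then have "2 * (2 ^ m * (l + 1) - 1) + 1 = 2 ^ Suc m * (l + 1) - 1" by simp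
  then show ?case using agree_double[OF Suc] by (simp add: mult.assoc)
qed (simp add: assms)

section \<open>Envelope words as windows of the sequence\<close>

lemma morph_sigma_stake:
  "morph sigma (stake l (sdrop n period_doubling)) = stake (2 * l) (sdrop (2 * n) period_doubling)"
proof (induction l)
  case (Suc l)
  have "sigma (pd (n + l)) = [pd (2 * (n + l)), pd (Suc (2 * (n + l)))]"
    unfolding pd_even pd_odd by (cases "pd (n + l)") simp_all
  then show ?case
    using Suc by (simp add: morph_def stake_Suc sdrop_snth algebra_simps del: stake.simps)
qed (simp add: morph_def)

lemma morph_sigma_power_stake:
  "(morph sigma ^^ m) (stake l (sdrop n period_doubling)) =
     stake (2 ^ m * l) (sdrop (2 ^ m * n) period_doubling)"
  by (induction m) (simp_all add: morph_sigma_stake mult.assoc)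

lemma morph_append: "morph f (u @ v) = morph f u @ morph f v"
  by (simp add: morph_def)

lemma morph_power_append:
  fixes f :: "'a \<Rightarrow> 'a list"
  shows "(morph f ^^ m) (u @ v) = (morph f ^^ m) u @ (morph f ^^ m) v"
  by (induction m) (simp_all add: morph_append)

lemma A_word_Suc: "A_word (Suc m) = stake (2 ^ m * 2) period_doubling"
proof -
  have "stake 2 (sdrop 0 period_doubling) = morph sigma [La]"
    using pd_small unfolding numeral_eq_Suc
    by (simp add: stake_Suc morph_def del: stake.simps(2))
  then have "A_word (Suc m) = (morph sigma ^^ m) (stake 2 (sdrop 0 period_doubling))"
    unfolding A_word_def funpow_Suc_right by simp
  then show ?thesis unfolding morph_sigma_power_stake by simp
qed

lemma B_word_Suc_append:
  "B_word (Suc m) @ B_word m = stake (2 ^ m * 3) (sdrop (2 ^ m * 3) period_doubling)"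
proof -
  have "stake 3 (sdrop 3 period_doubling) = morph sigma [Lb] @ [Lb]"
    using pd_small
    by (simp add: eval_nat_numeral stake_Suc sdrop_snth morph_def del: stake.simps(2) sdrop.simps(2))
  moreover have "B_word (Suc m) @ B_word m = (morph sigma ^^ m) (morph sigma [Lb] @ [Lb])"
    unfolding B_word_def funpow_Suc_right morph_power_append by simp
  ultimately show ?thesis by (metis morph_sigma_power_stake)
qed

text \<open>
  \<open>E1 (m + 1)\<close> and \<open>E2 (m + 1)\<close> are the images under \<open>sigma ^ m\<close> of \<open>ab\<close> at position 0 and of
  \<open>aab\<close> at position 3, without the last letter.
\<close>

definition win_lo :: "nat \<Rightarrow> nat" where
  "win_lo k = (if even k then 0 else 3) * 2 ^ (k div 2)"

definition win_hi :: "nat \<Rightarrow> nat" where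
  "win_hi k = (if even k then 2 else 6) * 2 ^ (k div 2)"

lemma win_Suc_Suc [simp]:
  "win_lo (Suc (Suc k)) = 2 * win_lo k" "win_hi (Suc (Suc k)) = 2 * win_hi k"
  by (simp_all add: win_lo_def win_hi_def)

lemma envelope_eq_stake:
  "envelope k = stake (win_hi k - win_lo k - 1) (sdrop (win_lo k) period_doubling)"
  by (simp add: envelope_def E1_def E2_def remove_suffix_def A_word_Suc B_word_Suc_append
      take_stake min_def win_hi_def win_lo_def mult.commute)

lemma sublist_stake_iff:
  "sublist w (stake n (sdrop i s)) \<longleftrightarrow> (\<exists>j\<in>occurrences w s. i \<le> j \<and> j + length w \<le> i + n)"
proof
  assume "sublist w (stake n (sdrop i s))"
  then obtain u v where uv: "stake n (sdrop i s) = u @ w @ v" by (auto simp: sublist_def)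
  then have len: "n = length u + length w + length v"
    by (metis add.assoc length_append length_stake)
  have "stake (length w) (sdrop (i + length u) s) = w"
  proof -
    have "take (length w) (drop (length u) (stake n (sdrop i s))) = w" by (simp add: uv)
    then show ?thesis by (simp add: len drop_stake take_stake sdrop_add min_def)
  qed
  then show "\<exists>j\<in>occurrences w s. i \<le> j \<and> j + length w \<le> i + n"
    using len by (intro bexI[of _ "i + length u"]) (auto simp: occurrences_def)
next
  assume "\<exists>j\<in>occurrences w s. i \<le> j \<and> j + length w \<le> i + n"
  then obtain j where j: "stake (length w) (sdrop j s) = w" "i \<le> j" "j + length w \<le> i + n"
    by (auto simp: occurrences_def)
  have "min (length w) (n - (j - i)) = length w" "i + (j - i) = j" using j by auto
  then have "take (length w) (drop (j - i) (stake n (sdrop i s))) = w"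
    using j(1) by (simp only: drop_stake take_stake sdrop_add)
  then show "sublist w (stake n (sdrop i s))"
    by (metis sublist_take sublist_drop sublist_order.order_trans)
qed

text \<open>The set \<open>S\<close> stands for the occurrences of a word of length
  \<open>l\<close>, so that being a factor of an envelope becomes arithmetic on positions. The upper
  bound is strict because the envelope lacks the last letter of its window.\<close>

definition fits :: "nat set \<Rightarrow> nat \<Rightarrow> nat \<Rightarrow> bool" where
  "fits S l k \<longleftrightarrow> (\<exists>j\<in>S. win_lo k \<le> j \<and> j + l < win_hi k)"

lemma win_lo_less_hi: "win_lo k < win_hi k"
  by (simp add: win_lo_def win_hi_def)

lemma sublist_envelope_iff:
  "sublist w (envelope k) \<longleftrightarrow> fits (occurrences w period_doubling) (length w) k"
  using win_lo_less_hi[of k] unfolding envelope_eq_stake sublist_stake_iff fits_def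
  by (intro bex_cong) auto

section \<open>Desubstitution and the structure of occurrences\<close>

definition base_occ :: "nat \<Rightarrow> nat set" where
  "base_occ k = (if even k then {j. pd j = La} else {j. pd j = La \<and> pd (Suc j) = La})"

text \<open>At each offset one of the two positions is even, so both letters are \<open>a\<close>.
  Length 3 is impossible: an odd \<open>n\<close> with \<open>a\<close> at \<open>n\<close> and
  \<open>n + 2\<close> would come from two adjacent letters \<open>b\<close>, one of them at an even
  position.\<close>

lemma agree_sync:
  assumes ag: "agree i j l" and par: "even i \<noteq> even j"
  shows "l \<le> 2 \<and> (\<forall>t<l. pd (i + t) = La)"
proof -
  have all: "pd (i + t) = La \<and> pd (j + t) = La" if "t < l" for t
    using ag par that pd_even'[of "i + t"] pd_even'[of "j + t"] unfolding agree_def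
    by (cases "even (i + t)") auto
  have no3: False if n: "odd n" "pd n = La" "pd (n + 2) = La" for n
  proof -
    have "pd (n div 2) = Lb" "pd (Suc (n div 2)) = Lb"
      using n pd_odd'[of n] pd_odd'[of "n + 2"] by auto
    then show False
      using pd_even'[of "n div 2"] pd_even'[of "Suc (n div 2)"] by (cases "even (n div 2)") auto
  qed
  have "l \<le> 2"
  proof (rule ccontr)
    assume "\<not> l \<le> 2"
    then show False
      using all[of 0] all[of 2] no3[of i] no3[of j] par by auto
  qed
  then show ?thesis using all by blast
qed

text \<open>Only odd positions carry information. A window of length \<open>l\<close> starting at
  \<open>2 * i' + e\<close> contains \<open>(e + l) div 2\<close> of them, coming from consecutive
  positions from \<open>i'\<close> on.\<close>

lemma agree_desubst:
  assumes "even i = even j"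
  shows "agree i j l \<longleftrightarrow> agree (i div 2) (j div 2) ((i + l) div 2 - i div 2)"
proof -
  obtain e where e: "i = 2 * (i div 2) + e" "j = 2 * (j div 2) + e" "e < 2"
    using assms by (metis mod_less_divisor mult_div_mod_eq parity_cases zero_less_numeral)
  define i' j' where "i' = i div 2" and "j' = j div 2"
  have ij: "i = 2 * i' + e" "j = 2 * j' + e" using e by (simp_all add: i'_def j'_def)
  have l': "(i + l) div 2 - i div 2 = (e + l) div 2" using e(3) by (simp add: ij)
  have "agree i' j' ((e + l) div 2)" if ag: "agree i j l"
    unfolding agree_def
  proof (intro allI impI)
    fix s assume s: "s < (e + l) div 2"
    have "Suc (2 * s) - e < l" using s e(3) by linarith
    then have "pd (i + (Suc (2 * s) - e)) = pd (j + (Suc (2 * s) - e))"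
      using ag unfolding agree_def by blast
    then have "pd (Suc (2 * (i' + s))) = pd (Suc (2 * (j' + s)))"
      using e(3) by (simp add: ij algebra_simps)
    then show "pd (i' + s) = pd (j' + s)" unfolding pd_odd by (auto split: if_splits)
  qed
  moreover have "agree i j l" if ag: "agree i' j' ((e + l) div 2)"
  proof -
    show ?thesis
      using agree_shift[OF agree_double[OF ag], of e l] unfolding ij by auto
  qed
  ultimately show ?thesis unfolding l'[unfolded i'_def] i'_def j'_def by blast
qed

lemma fits_affine:
  assumes "e < 2"
  shows "fits ((\<lambda>j. 2 * j + e) ` S) l (Suc (Suc k)) \<longleftrightarrow> fits S ((e + l) div 2) k"
proof -
  have "win_lo (Suc (Suc k)) \<le> 2 * j + e \<and> 2 * j + e + l < win_hi (Suc (Suc k)) \<longleftrightarrow>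
      win_lo k \<le> j \<and> j + (e + l) div 2 < win_hi k" for j
    unfolding win_Suc_Suc using assms by linarith
  then show ?thesis by (simp add: fits_def)
qed

text \<open>Here \<open>i\<close> is one occurrence of the word and \<open>k\<close> the index of
  its envelope. The induction is on \<open>i + l\<close> and not on \<open>l\<close>, because a
  single letter at an odd position desubstitutes to a single letter. The bound on
  \<open>c + l\<close> later makes the offset \<open>c\<close> small enough for the windows of
  \<open>agree_power\<close>.\<close>

lemma occurrences_structure:
  assumes "l > 0"
  shows "\<exists>k c. fits {j. agree i j l} l k \<and> (\<forall>k'<k. \<not> fits {j. agree i j l} l k') \<and>
    c + l < (if even k then 2 else 3) * 2 ^ (k div 2) \<and>
    {j. agree i j l} = (\<lambda>j. c + 2 ^ (k div 2) * j) ` base_occ k"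
  using assms
proof (induction "i + l" arbitrary: i l rule: less_induct)
  case less
  let ?S = "{j. agree i j l}"
  show ?case
  proof (cases "l \<le> 2 \<and> (\<forall>t<l. pd (i + t) = La)")
    case True
    then consider "l = 1" "pd i = La" | "l = 2" "pd i = La" "pd (Suc i) = La"
      using less.prems by (cases "l = 1") (auto simp: le_Suc_eq numeral_2_eq_2 All_less_Suc2)
    then show ?thesis
    proof cases
      case 1
      then have S: "?S = base_occ 0" by (auto simp: agree_def base_occ_def)
      have "fits (base_occ 0) l 0"
        unfolding fits_def by (rule bexI[of _ 0])
          (simp_all add: 1 base_occ_def win_lo_def win_hi_def pd_small)
      then show ?thesis
        unfolding S by (intro exI[of _ 0]) (simp add: 1)
    next
      case 2
      then have S: "?S = base_occ 1"
        by (auto simp: agree_def base_occ_def numeral_2_eq_2 less_Suc_eq)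
      \<comment> \<open>The first occurrence of \<open>aa\<close> is at 2, but the window of index 1
        starts at 3, so the occurrence at 3 is the witness.\<close>
      have "fits (base_occ 1) l 1"
        unfolding fits_def by (rule bexI[of _ 3])
          (simp_all add: 2 base_occ_def win_lo_def win_hi_def pd_small)
      moreover have "\<not> fits (base_occ 1) l k'" if "k' < 1" for k'
        using that by (auto simp: 2 fits_def win_hi_def)
      ultimately show ?thesis
        unfolding S by (intro exI[of _ 1] exI[of _ 0]) (simp add: 2)
    qed
  next
    case False
    define i' e where "i' = i div 2" and "e = i mod 2"
    define l' where "l' = (e + l) div 2"
    have e: "e < 2" by (simp add: e_def)
    have i: "i = 2 * i' + e" by (simp add: i'_def e_def)
    have l'_alt: "(i + l) div 2 - i div 2 = l'" unfolding l'_def i using e by simp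
    \<comment> \<open>Only a single letter at an even position would give \<open>l' = 0\<close>, and
      that letter is \<open>a\<close>, which this case excludes.\<close>
    have "l' > 0"
    proof (cases "l = 1")
      case True
      then have "pd i \<noteq> La" using False by auto
      then have "odd i" using pd_even' by blast
      then show ?thesis by (simp add: l'_def True e_def odd_iff_mod_2_eq_one)
    next
      case l: False
      then show ?thesis using less.prems by (simp add: l'_def)
    qed
    moreover have "i' + l' < i + l"
      using less.prems e by (simp add: i l'_def)
    ultimately obtain k c where k: "fits {j. agree i' j l'} l' k"
        "\<forall>k'<k. \<not> fits {j. agree i' j l'} l' k'"
        "c + l' < (if even k then 2 else 3) * 2 ^ (k div 2)"
        "{j. agree i' j l'} = (\<lambda>j. c + 2 ^ (k div 2) * j) ` base_occ k"
      using less.hyps[of i' l'] by blast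
    have S: "?S = (\<lambda>j. 2 * j + e) ` {j. agree i' j l'}"
    proof (intro set_eqI iffI)
      fix j assume "j \<in> ?S"
      then have ag: "agree i j l" by simp
      then have par: "even i = even j" using agree_sync[OF ag] False by blast
      then have "j = 2 * (j div 2) + e" unfolding e_def
        by (metis mult_div_mod_eq parity_cases)
      moreover have "agree i' (j div 2) l'"
        using ag agree_desubst[OF par, of l] unfolding l'_alt i'_def by blast
      ultimately show "j \<in> (\<lambda>j. 2 * j + e) ` {j. agree i' j l'}" by blast
    next
      fix j assume "j \<in> (\<lambda>j. 2 * j + e) ` {j. agree i' j l'}"
      then obtain j' where j': "j = 2 * j' + e" "agree i' j' l'" by blast
      then have "even i = even j" "j div 2 = j'" using e by (auto simp: i)
      then show "j \<in> ?S" using agree_desubst[of i j l] j' unfolding l'_alt i'_def by simp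
    qed
    have fits: "fits ?S l (Suc (Suc k')) \<longleftrightarrow> fits {j. agree i' j l'} l' k'" for k'
      unfolding S l'_def by (rule fits_affine[OF e])
    have no_a: False if "j \<in> ?S" "l \<le> 2" "\<forall>t<l. pd (j + t) = La" for j
      using that False by (auto simp: agree_def)
    \<comment> \<open>Indices 0 and 1 belong to the envelopes \<open>a\<close> and
      \<open>aa\<close>, whose nonempty factors are exactly the two base cases.\<close>
    have n0: "\<not> fits ?S l 0"
    proof
      assume "fits ?S l 0"
      then obtain j where "j \<in> ?S" "j + l < 2"
        by (auto simp: fits_def win_lo_def win_hi_def)
      moreover from this have "j = 0" "l = 1" using less.prems by auto
      ultimately show False using no_a[of j] pd_small by auto
    qed
    have n1: "\<not> fits ?S l (Suc 0)"
    proof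
      assume "fits ?S l (Suc 0)"
      then obtain j where j: "j \<in> ?S" "3 \<le> j" "j + l < 6"
        by (auto simp: fits_def win_lo_def win_hi_def)
      have "pd (j + t) = La" if "t < l" for t
      proof -
        have "j + t = 3 \<or> j + t = 4" using that j by linarith
        then show ?thesis using pd_small by auto
      qed
      then show False using no_a[of j] j by auto
    qed
    have min: "\<not> fits ?S l k'" if "k' < Suc (Suc k)" for k'
    proof -
      consider "k' = 0" | "k' = Suc 0" | k'' where "k' = Suc (Suc k'')"
        by (metis not0_implies_Suc)
      then show ?thesis
        using n0 n1 fits k(2) that by cases auto
    qed
    have "?S = (\<lambda>j. (2 * c + e) + 2 ^ (Suc (Suc k) div 2) * j) ` base_occ (Suc (Suc k))"
      unfolding S k(4) by (simp add: image_image base_occ_def algebra_simps)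
    \<comment> \<open>Rounding gives \<open>2 * l' \<ge> e + l - 1\<close>; doubling the strict
      inequality leaves a slack of 2 that absorbs the lost 1.\<close>
    moreover have "(2 * c + e) + l < (if even (Suc (Suc k)) then 2 else 3) * 2 ^ (Suc (Suc k) div 2)"
      using k(3) e by (auto simp: l'_def)
    ultimately show ?thesis using min k(1) fits by blast
  qed
qed


section \<open>Occurrences of \<open>a\<close> and the letters of \<open>Theta1\<close> and
  \<open>Theta2\<close>\<close>

lemma enumerate_range_strict_mono:
  fixes f :: "nat \<Rightarrow> nat"
  assumes "strict_mono f"
  shows "enumerate (range f) = f"
proof
  fix n
  have inf: "infinite (range f)"
    using assms by (simp add: finite_image_iff strict_mono_imp_inj_on)
  show "enumerate (range f) n = f n"
  proof (induction n)
    case 0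
    have "(LEAST x. x \<in> range f) = f 0"
      using assms by (intro Least_equality) (auto simp: strict_mono_less_eq)
    then show ?case by (simp add: enumerate_0)
  next
    case (Suc n)
    have "(LEAST x. x \<in> range f \<and> f n < x) = f (Suc n)"
      using assms by (intro Least_equality) (auto simp: strict_mono_less_eq strict_mono_less)
    then show ?case using Suc inf by (simp add: enumerate_Suc'')
  qed
qed

definition a_pos :: "nat \<Rightarrow> nat" where
  "a_pos = enumerate {j. pd j = La}"

lemma infinite_a: "infinite {j. pd j = La}"
  unfolding infinite_nat_iff_unbounded_le
proof
  fix m
  show "\<exists>n\<ge>m. n \<in> {j. pd j = La}" by (intro exI[of _ "2 * m"]) (use pd_even in auto)
qed

lemma pd_a_pos: "pd (a_pos p) = La"
  using enumerate_in_set[OF infinite_a] unfolding a_pos_def by blast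

lemma range_a_pos: "range a_pos = {j. pd j = La}"
  using range_enumerate[OF infinite_a] by (simp add: a_pos_def)

lemma strict_mono_a_pos: "strict_mono a_pos"
  using strict_mono_enumerate[OF infinite_a] by (simp add: a_pos_def)

lemma pd_Suc_of_b: "pd j = Lb \<Longrightarrow> pd (Suc j) = La"
  using pd_even'[of j] pd_even'[of "Suc j"] by (cases "even j") auto

lemma a_pos_0: "a_pos 0 = 0"
  unfolding a_pos_def enumerate_0 using pd_small by (intro Least_equality) auto

text \<open>No two letters \<open>b\<close> are adjacent, so the gap is 1 or 2.\<close>

lemma a_pos_Suc:
  "a_pos (Suc p) = (if pd (Suc (a_pos p)) = La then a_pos p + 1 else a_pos p + 2)"
proof -
  have "a_pos (Suc p) = (LEAST s. pd s = La \<and> a_pos p < s)"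
    unfolding a_pos_def enumerate_Suc''[OF infinite_a] by simp
  also have "\<dots> = (if pd (Suc (a_pos p)) = La then a_pos p + 1 else a_pos p + 2)"
  proof (cases "pd (Suc (a_pos p)) = La")
    case True
    then show ?thesis by (auto intro!: Least_equality)
  next
    case False
    then have "pd (Suc (Suc (a_pos p))) = La" using pd_Suc_of_b by simp
    moreover have "a_pos p + 2 \<le> y" if "pd y = La" "a_pos p < y" for y
      using that False by (cases "y = Suc (a_pos p)") auto
    ultimately show ?thesis using False by (auto intro!: Least_equality)
  qed
  finally show ?thesis .
qed

lemma morph_inf_sdrop:
  assumes "f (s !! n) \<noteq> []"
  shows "morph_inf f (sdrop n s) = f (s !! n) @- morph_inf f (sdrop (Suc n) s)"
proof -
  have "sdrop n s = s !! n ## sdrop (Suc n) s"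
    by (metis sdrop_simps(1) sdrop_simps(2) stream.collapse)
  then have "morph_inf f (sdrop n s) = morph_inf f (s !! n ## sdrop (Suc n) s)" by (rule arg_cong)
  then show ?thesis using assms by (simp add: morph_inf_def)
qed

text \<open>
  The image of the letter number \<open>n\<close> under \<open>tau1\<close> (under \<open>tau2\<close>) lists the gaps that start at an
  \<open>a\<close> in positions \<open>2 n, 2 n + 1\<close> (and at the two corresponding \<open>aa\<close>); the second case is the
  middle of the image of a \<open>b\<close>.
\<close>

lemma theta_state:
  "\<exists>n. (a_pos p = 2 * n \<and>
          sdrop p Theta1 = morph_inf tau1 (sdrop n period_doubling) \<and>
          sdrop (2 * p) Theta2 = morph_inf tau2 (sdrop n period_doubling)) \<or>
       (a_pos p = Suc (2 * n) \<and> pd n = Lb \<and>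
          sdrop p Theta1 = Lb ## morph_inf tau1 (sdrop (Suc n) period_doubling) \<and>
          sdrop (2 * p) Theta2 = Ta ## Tc ## morph_inf tau2 (sdrop (Suc n) period_doubling))"
proof (induction p)
  case 0
  show ?case by (intro exI[of _ 0]) (simp add: a_pos_0 Theta1_def Theta2_def)
next
  case (Suc p)
  have d1: "sdrop (Suc p) Theta1 = stl (sdrop p Theta1)"
    and d2: "sdrop (2 * Suc p) Theta2 = stl (stl (sdrop (2 * p) Theta2))"
    by (simp_all only: sdrop_simps mult_Suc_right add_2_eq_Suc)
  from Suc obtain n where
    "(a_pos p = 2 * n \<and>
          sdrop p Theta1 = morph_inf tau1 (sdrop n period_doubling) \<and>
          sdrop (2 * p) Theta2 = morph_inf tau2 (sdrop n period_doubling)) \<or>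
       (a_pos p = Suc (2 * n) \<and> pd n = Lb \<and>
          sdrop p Theta1 = Lb ## morph_inf tau1 (sdrop (Suc n) period_doubling) \<and>
          sdrop (2 * p) Theta2 = Ta ## Tc ## morph_inf tau2 (sdrop (Suc n) period_doubling))"
    by blast
  \<comment> \<open>If the source letter is \<open>a\<close>, the gap is 2 and leads to the next
    block. If it is \<open>b\<close>, its block is \<open>aa\<close>: a first gap of 1 leads inside
    the block, a second one to the next block.\<close>
  then consider (block_a) "pd n = La" "a_pos p = 2 * n"
        "sdrop p Theta1 = morph_inf tau1 (sdrop n period_doubling)"
        "sdrop (2 * p) Theta2 = morph_inf tau2 (sdrop n period_doubling)"
    | (block_b) "pd n = Lb" "a_pos p = 2 * n"
        "sdrop p Theta1 = morph_inf tau1 (sdrop n period_doubling)"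
        "sdrop (2 * p) Theta2 = morph_inf tau2 (sdrop n period_doubling)"
    | (inside) "pd n = Lb" "a_pos p = Suc (2 * n)"
        "sdrop p Theta1 = Lb ## morph_inf tau1 (sdrop (Suc n) period_doubling)"
        "sdrop (2 * p) Theta2 = Ta ## Tc ## morph_inf tau2 (sdrop (Suc n) period_doubling)"
    by (cases "pd n") auto
  then show ?case
  proof cases
    case block_a
    then show ?thesis unfolding d1 d2 a_pos_Suc
      by (intro exI[of _ "Suc n"] disjI1)
        (simp add: morph_inf_sdrop[of _ _ n] del: sdrop.simps sdrop_simps)
  next
    case block_b
    then show ?thesis unfolding d1 d2 a_pos_Suc
      by (intro exI[of _ n] disjI2)
        (simp add: morph_inf_sdrop[of _ _ n] del: sdrop.simps sdrop_simps)
  next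
    case inside
    then show ?thesis unfolding d1 d2 a_pos_Suc
      using pd_even[of "Suc n"]
      by (intro exI[of _ "Suc n"] disjI1) simp
  qed
qed

text \<open>\<open>Theta2\<close> is the image of \<open>Theta1\<close> under the morphism sending
  \<open>a\<close> to \<open>ab\<close> and \<open>b\<close> to \<open>ac\<close>, since
  \<open>tau2\<close> is this morphism composed with \<open>tau1\<close>. In \<open>Theta1\<close>
  the letter \<open>a\<close> encodes gap 2 and \<open>b\<close> encodes gap 1.\<close>

lemma theta_snth:
  "Theta1 !! p = (if pd (Suc (a_pos p)) = La then Lb else La)"
  "Theta2 !! (2 * p) = Ta"
  "Theta2 !! Suc (2 * p) = (if Theta1 !! p = La then Tb else Tc)"
proof -
  have snth: "Theta1 !! p = shd (sdrop p Theta1)" "Theta2 !! (2 * p) = shd (sdrop (2 * p) Theta2)"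
    "Theta2 !! Suc (2 * p) = shd (stl (sdrop (2 * p) Theta2))"
    by (simp_all only: sdrop_simps)
  obtain n where
    "(a_pos p = 2 * n \<and>
          sdrop p Theta1 = morph_inf tau1 (sdrop n period_doubling) \<and>
          sdrop (2 * p) Theta2 = morph_inf tau2 (sdrop n period_doubling)) \<or>
       (a_pos p = Suc (2 * n) \<and> pd n = Lb \<and>
          sdrop p Theta1 = Lb ## morph_inf tau1 (sdrop (Suc n) period_doubling) \<and>
          sdrop (2 * p) Theta2 = Ta ## Tc ## morph_inf tau2 (sdrop (Suc n) period_doubling))"
    using theta_state by blast
  then have "Theta1 !! p = (if pd (Suc (a_pos p)) = La then Lb else La) \<and>
      Theta2 !! (2 * p) = Ta \<and> Theta2 !! Suc (2 * p) = (if Theta1 !! p = La then Tb else Tc)"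
    using pd_even[of "Suc n"] unfolding snth
    by (cases "pd n") (auto simp: morph_inf_sdrop[of _ _ n] simp del: sdrop.simps sdrop_simps)
  then show "Theta1 !! p = (if pd (Suc (a_pos p)) = La then Lb else La)"
    "Theta2 !! (2 * p) = Ta"
    "Theta2 !! Suc (2 * p) = (if Theta1 !! p = La then Tb else Tc)" by auto
qed

text \<open>The agreement has length \<open>d + 1\<close> because the \<open>a\<close> that closes
  the gap is common too; after scaling, this letter makes room for the offset
  \<open>c\<close>.\<close>

lemma a_pos_gap:
  assumes "Theta1 !! p = Theta1 !! q"
  obtains d where "d > 0" "a_pos (Suc p) = a_pos p + d" "a_pos (Suc q) = a_pos q + d"
    "agree (a_pos p) (a_pos q) (d + 1)"
proof (cases "Theta1 !! p = La")
  case True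
  then have b: "pd (Suc (a_pos p)) = Lb" "pd (Suc (a_pos q)) = Lb"
    using assms theta_snth(1)[of p] theta_snth(1)[of q] by (auto split: if_splits)
  then have "agree (a_pos p) (a_pos q) (2 + 1)"
    using pd_a_pos pd_Suc_of_b[OF b(1)] pd_Suc_of_b[OF b(2)]
    by (auto simp: agree_def less_Suc_eq numeral_2_eq_2)
  then show ?thesis using b by (intro that[of 2]) (auto simp: a_pos_Suc)
next
  case False
  then have b: "pd (Suc (a_pos p)) = La" "pd (Suc (a_pos q)) = La"
    using assms theta_snth(1)[of p] theta_snth(1)[of q] by (auto split: if_splits)
  then have "agree (a_pos p) (a_pos q) (1 + 1)"
    using pd_a_pos by (auto simp: agree_def less_Suc_eq)
  then show ?thesis using b by (intro that[of 1]) (auto simp: a_pos_Suc)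
qed

section \<open>Occurrences of \<open>aa\<close>\<close>

definition aa_pos :: "nat \<Rightarrow> nat" where
  "aa_pos p = 4 * a_pos (p div 2) + 2 + p mod 2"

lemma aa_pos_simps [simp]:
  "aa_pos (2 * p) = 4 * a_pos p + 2"
  "aa_pos (Suc (2 * p)) = 4 * a_pos p + 3"
  "aa_pos (Suc (Suc (2 * p))) = 4 * a_pos (Suc p) + 2"
  by (simp_all add: aa_pos_def)

text \<open>The square of \<open>sigma\<close> sends \<open>a\<close> to \<open>abaa\<close> and
  \<open>b\<close> to \<open>abab\<close>, and each block is followed by \<open>a\<close>. Hence
  \<open>aa\<close> starts exactly at offsets 2 and 3 of the images of \<open>a\<close>.\<close>

lemma aa_iff: "pd j = La \<and> pd (Suc j) = La \<longleftrightarrow> (\<exists>q. pd q = La \<and> (j = 4 * q + 2 \<or> j = 4 * q + 3))"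
proof -
  have b: "pd n = Lb \<longleftrightarrow> (\<exists>q. pd q = La \<and> n = Suc (2 * q))" for n
  proof (cases "even n")
    case True
    then show ?thesis by (auto simp: pd_even')
  next
    case False
    then obtain q where "n = Suc (2 * q)" by (auto elim: oddE)
    then show ?thesis by auto
  qed
  have "pd j = La \<and> pd (Suc j) = La \<longleftrightarrow> (\<exists>n. pd n = Lb \<and> (j = 2 * n \<or> j = Suc (2 * n)))"
  proof (cases "even j")
    case True
    then obtain n where "j = 2 * n" by blast
    then show ?thesis by auto presburger
  next
    case False
    then obtain n where n: "j = Suc (2 * n)" by (auto elim: oddE)
    then show ?thesis using pd_even[of "Suc n"] by auto presburger
  qed
  also have "\<dots> \<longleftrightarrow> (\<exists>q. pd q = La \<and> (j = 4 * q + 2 \<or> j = 4 * q + 3))"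
    unfolding b by auto
  finally show ?thesis .
qed

lemma range_aa_pos: "range aa_pos = {j. pd j = La \<and> pd (Suc j) = La}"
proof -
  have "aa_pos p \<in> (\<Union>n. {aa_pos (2 * n), aa_pos (Suc (2 * n))})" for p
    by (cases "even p") (blast elim: evenE, auto elim!: oddE simp del: aa_pos_simps)
  then have "range aa_pos = (\<Union>n. {aa_pos (2 * n), aa_pos (Suc (2 * n))})" by blast
  also have "\<dots> = (\<Union>q\<in>range a_pos. {4 * q + 2, 4 * q + 3})"
    by (auto simp: aa_pos_def)
  finally show ?thesis unfolding range_a_pos aa_iff by auto
qed

lemma strict_mono_aa_pos: "strict_mono aa_pos"
  unfolding strict_mono_Suc_iff
proof
  fix p
  show "aa_pos p < aa_pos (Suc p)"
  proof (cases "even p")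
    case True
    then show ?thesis by (auto simp: aa_pos_def)
  next
    case False
    then obtain n where "p = Suc (2 * n)" by (auto elim: oddE)
    moreover have "a_pos n < a_pos (Suc n)" using strict_mono_a_pos by (simp add: strict_mono_Suc_iff)
    ultimately show ?thesis by (simp add: aa_pos_def)
  qed
qed

section \<open>Equal letters give equal return words\<close>

lemma return_word_eqI:
  assumes "strict_mono f" "occurrences w period_doubling = range f"
    and "f (Suc p) = f p + g" "f (Suc q) = f q + g" "agree (f p) (f q) g"
  shows "return_word w (Suc p) = return_word w (Suc q)"
proof -
  have "occ_pos w (Suc n) = f n" for n
    using enumerate_range_strict_mono[OF assms(1)] by (simp add: occ_pos_def assms(2))
  then show ?thesis
    using assms(3-5) by (simp add: return_word_def stake_sdrop_eq_iff_agree)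
qed

lemma strict_mono_affine:
  fixes f :: "nat \<Rightarrow> nat"
  assumes "strict_mono f" "M > 0"
  shows "strict_mono (\<lambda>p. c + M * f p)"
  using assms by (simp add: strict_mono_def)

lemma return_word_eq_Theta1:
  assumes occ: "occurrences w period_doubling = (\<lambda>j. c + 2 ^ m * j) ` {j. pd j = La}"
    and c: "c < 2 * 2 ^ m" and th: "Theta1 !! p = Theta1 !! q"
  shows "return_word w (Suc p) = return_word w (Suc q)"
proof -
  define M :: nat where "M = 2 ^ m"
  have M: "M > 0" by (simp add: M_def)
  obtain d where d: "d > 0" "a_pos (Suc p) = a_pos p + d" "a_pos (Suc q) = a_pos q + d"
    "agree (a_pos p) (a_pos q) (d + 1)"
    using a_pos_gap[OF th] .
  \<comment> \<open>The scaled windows agree on \<open>M * (d + 2) - 1\<close> letters; skipping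
    \<open>c < 2 * M\<close> of them leaves the \<open>M * d\<close> letters of the return
    word.\<close>
  have "c + M * d \<le> M * (d + 1 + 1) - 1" using c M by (simp add: M_def[symmetric] algebra_simps)
  from agree_shift[OF agree_power[OF d(4), of m, folded M_def] this]
  have ag: "agree (c + M * a_pos p) (c + M * a_pos q) (M * d)" by (simp add: add.commute)
  have "occurrences w period_doubling = range (\<lambda>p. c + M * a_pos p)"
    unfolding occ range_a_pos[symmetric] M_def by (simp add: image_image)
  then show ?thesis
    by (rule return_word_eqI[OF strict_mono_affine[OF strict_mono_a_pos M]])
      (use d ag in \<open>simp_all add: algebra_simps\<close>)
qed

lemma return_word_eq_Theta2:
  assumes occ: "occurrences w period_doubling =
      (\<lambda>j. c + 2 ^ m * j) ` {j. pd j = La \<and> pd (Suc j) = La}"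
    and c: "c < 3 * 2 ^ m" and th: "Theta2 !! p = Theta2 !! q"
  shows "return_word w (Suc p) = return_word w (Suc q)"
proof -
  define M :: nat where "M = 2 ^ m"
  have M: "M > 0" by (simp add: M_def)
  have M4: "2 ^ (m + 2) = 4 * M" by (simp add: M_def)
  have occ': "occurrences w period_doubling = range (\<lambda>p. c + M * aa_pos p)"
    unfolding occ range_aa_pos[symmetric] M_def by (simp add: image_image)
  note eqI = return_word_eqI[OF strict_mono_affine[OF strict_mono_aa_pos M] occ']
  \<comment> \<open>\<open>Ta\<close> stands only at even indices, \<open>Tb\<close> and
    \<open>Tc\<close> only at odd ones.\<close>
  have par: "even p = even q"
    using th theta_snth(2,3)[of "p div 2"] theta_snth(2,3)[of "q div 2"]
    by (cases "even p"; cases "even q") (auto split: if_splits)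
  show ?thesis
  proof (cases "even p")
    case True
    then obtain p' q' where pq: "p = 2 * p'" "q = 2 * q'" using par by (metis evenE)
    \<comment> \<open>The gap from \<open>4 * q + 2\<close> to \<open>4 * q + 3\<close> is 1 for
      every \<open>a\<close>, so agreement in that one letter is enough: scaled by
      \<open>4 * M\<close> it covers \<open>8 * M - 1\<close> positions.\<close>
    have "agree (a_pos p') (a_pos q') 1" using pd_a_pos by (simp add: agree_def)
    from agree_power[OF this, of "m + 2", unfolded M4]
    have "agree (4 * M * a_pos p' + (c + 2 * M)) (4 * M * a_pos q' + (c + 2 * M)) M"
      by (rule agree_shift) (use c M in \<open>simp add: M_def[symmetric]\<close>)
    then show ?thesis unfolding pq by (intro eqI[of _ M]) (simp_all, simp_all add: algebra_simps)
  next
    case False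
    then obtain p' q' where pq: "p = Suc (2 * p')" "q = Suc (2 * q')"
      using par by (metis oddE Suc_eq_plus1)
    have "Theta1 !! p' = Theta1 !! q'"
      using th theta_snth(3)[of p'] theta_snth(3)[of q'] unfolding pq
      by (cases "Theta1 !! p'"; cases "Theta1 !! q'") auto
    then obtain d where d: "d > 0" "a_pos (Suc p') = a_pos p' + d" "a_pos (Suc q') = a_pos q' + d"
      "agree (a_pos p') (a_pos q') (d + 1)"
      using a_pos_gap by metis
    \<comment> \<open>The gap from \<open>4 * a_pos p' + 3\<close> to
      \<open>4 * a_pos (Suc p') + 2\<close> is \<open>4 * d - 1\<close>; the form
      \<open>4 * d' + 3\<close> avoids truncated subtraction.\<close>
    obtain d' where d': "d = Suc d'" using d(1) by (cases d) auto
    from agree_power[OF d(4), of "m + 2", unfolded M4]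
    have "agree (4 * M * a_pos p' + (c + 3 * M)) (4 * M * a_pos q' + (c + 3 * M)) (M * (4 * d' + 3))"
      by (rule agree_shift) (use c M in \<open>simp add: M_def[symmetric] d' algebra_simps\<close>)
    then show ?thesis unfolding pq
      by (intro eqI[of _ "M * (4 * d' + 3)"]) (use d(2,3) d' in \<open>simp_all, simp_all add: algebra_simps\<close>)
  qed
qed

section \<open>Recognising the kind of envelope, and the conclusion\<close>

lemma power2_mod3: "(2 ^ n :: nat) mod 3 \<noteq> 0"
  by (induction n) (auto simp: mod_eq_0_iff_dvd, presburger)

text \<open>The hypothesis equates words, not indices. The window lengths are
  \<open>2 * 2 ^ a\<close> for even and \<open>3 * 2 ^ b\<close> for odd indices, and these never
  coincide because 3 does not divide a power of two.\<close>

lemma Env_parity: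
  assumes "Env w = envelope j" "fits (occurrences w period_doubling) (length w) k"
    "\<forall>k'<k. \<not> fits (occurrences w period_doubling) (length w) k'"
  shows "even k = even j"
proof -
  have "(LEAST k. sublist w (envelope k)) = k"
    unfolding sublist_envelope_iff using assms(2,3)
    by (intro Least_equality) (auto simp: not_less[symmetric])
  then have "length (envelope k) = length (envelope j)" using assms(1) by (simp add: Env_def)
  then have "win_hi k - win_lo k = win_hi j - win_lo j"
    using win_lo_less_hi[of k] win_lo_less_hi[of j] by (simp add: envelope_eq_stake)
  moreover have "2 * 2 ^ a \<noteq> 3 * (2 ^ b :: nat)" for a b
    using power2_mod3[of "Suc a"] by auto
  ultimately show ?thesis
    by (cases "even k"; cases "even j") (auto simp: win_lo_def win_hi_def, metis)
qed

theorem theorem4p1: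
  fixes w :: "letter list"
  assumes "w \<noteq> []" and "is_factor w period_doubling"
  shows "((\<exists>m\<ge>1. Env w = E1 m) \<longrightarrow>
            (\<forall>p\<ge>1. (letter_at Theta1 p = La \<longrightarrow> return_word w p = return_word w 1) \<and>
                   (letter_at Theta1 p = Lb \<longrightarrow> return_word w p = return_word w 2))) \<and>
         ((\<exists>m\<ge>1. Env w = E2 m) \<longrightarrow>
            (\<forall>p\<ge>1. (letter_at Theta2 p = Ta \<longrightarrow> return_word w p = return_word w 1) \<and>
                   (letter_at Theta2 p = Tb \<longrightarrow> return_word w p = return_word w 2) \<and>
                   (letter_at Theta2 p = Tc \<longrightarrow> return_word w p = return_word w 4)))"
proof -
  let ?S = "occurrences w period_doubling"
  obtain i where i: "i \<in> ?S" using assms(2) by (auto simp: is_factor_def)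
  then have "?S = {j. agree i j (length w)}"
    unfolding occurrences_def stake_sdrop_eq_iff_agree[symmetric] by auto
  with occurrences_structure[of "length w" i] assms(1) obtain k c where
    k: "fits ?S (length w) k" "\<forall>k'<k. \<not> fits ?S (length w) k'"
      "c + length w < (if even k then 2 else 3) * 2 ^ (k div 2)"
      "?S = (\<lambda>j. c + 2 ^ (k div 2) * j) ` base_occ k"
    by auto
  have pred: "return_word w p = return_word w (Suc (p - 1))" if "p \<ge> 1" for p using that by simp
  have a1: "a_pos 1 = 2" using a_pos_Suc[of 0] pd_small by (simp add: a_pos_0)
  \<comment> \<open>\<open>Theta1\<close> begins with \<open>ab\<close> and \<open>Theta2\<close>
    with \<open>abac\<close>. The first places of their letters, counted from 0, are 0, 1 and 0, 1,
    3; this is why the return words 1, 2 and 1, 2, 4 serve as representatives.\<close>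
  have t1: "Theta1 !! 0 = La" "Theta1 !! 1 = Lb"
    using theta_snth(1)[of 0, unfolded a_pos_0] theta_snth(1)[of 1, unfolded a1] pd_small
    by simp_all
  have t2: "Theta2 !! 0 = Ta" "Theta2 !! 1 = Tb" "Theta2 !! 3 = Tc"
    using theta_snth(2,3)[of 0] theta_snth(3)[of 1] t1 by (simp_all add: numeral_3_eq_3)
  have part1: "return_word w p = return_word w (Suc q)"
    if "Env w = E1 m" "m \<ge> 1" "p \<ge> 1" "letter_at Theta1 p = Theta1 !! q" for m p q
  proof -
    have "E1 m = envelope (2 * (m - 1))" using that(2) by (simp add: envelope_def)
    then have "even k" using Env_parity[OF _ k(1,2)] that(1) by simp
    then show ?thesis
      unfolding pred[OF that(3)] using k(3,4) that(4)
      by (intro return_word_eq_Theta1[of w c "k div 2"]) (simp_all add: base_occ_def letter_at_def)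
  qed
  have part2: "return_word w p = return_word w (Suc q)"
    if "Env w = E2 m" "m \<ge> 1" "p \<ge> 1" "letter_at Theta2 p = Theta2 !! q" for m p q
  proof -
    have "E2 m = envelope (Suc (2 * (m - 1)))" using that(2) by (simp add: envelope_def)
    then have "odd k" using Env_parity[OF _ k(1,2)] that(1) by simp
    then show ?thesis
      unfolding pred[OF that(3)] using k(3,4) that(4)
      by (intro return_word_eq_Theta2[of w c "k div 2"]) (simp_all add: base_occ_def letter_at_def)
  qed
  show ?thesis
    using part1[of _ _ 0] part1[of _ _ 1] part2[of _ _ 0] part2[of _ _ 1] part2[of _ _ 3] t1 t2
    by (auto simp: numeral_2_eq_2 eval_nat_numeral)
qed

end
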